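(* Let $d\in\{1,2,3\}$, $\delta>0$, $\tau>0$, and let $U_\delta^{-1},U_\delta^0\in\mathcal M_h$ be given. Let $(U_\delta^n)_{n\ge -1}\subset\mathcal M_h$ satisfy, for $n\ge0$, the second-order BDF scheme $$\begin{aligned}\frac{3U_\delta^{n+1}-4U_\delta^n+U_\delta^{n-1}}{2\tau}=&-\epsilon\mathcal L_{\delta,h}U_\delta^{n+1}-\frac1\epsilon\left[2W'(U_\delta^n)-W'(U_\delta^{n-1})\right]\\&-\gamma B_h\mathcal L_{\delta,h}^{-1}(U_\delta^{n+1}-2U_\delta^n+U_\delta^{n-1})-A_h(U_\delta^{n+1}-2U_\delta^n+U_\delta^{n-1})\\&-\gamma\mathcal L_{\delta,h}^{-1}\left[2U_\delta^n-U_\delta^{n-1}-\omega\right]-M\left[\langle 2U_\delta^n-U_\delta^{n-1},1\rangle_h-\omega|\Omega|\right].\end{aligned}$$ Put $$C_h=\frac{L_{W''}}{2\epsilon}+\frac\gamma2\|\mathcal L_{\delta,h}^{-1}\|_{L^2,h}+\frac M2|\Omega|,$$ $$E_h(U)=\frac\epsilon2\langle\mathcal L_{\delta,h}U,U\rangle_h+\frac1\epsilon\langle W(U),1\rangle_h+\frac\gamma2\langle\mathcal L_{\delta,h}^{-1}[U-\omega],U-\omega\rangle_h+\frac M2\langle U-\omega,1\rangle_h^2,$$ $$\tilde E_h(U,V)=E_h(U)+\left(\frac{A_h}2+\frac1{4\tau}+C_h\right)\|U-V\|_{L^2,h}^2+\frac{\gamma B_h}2\|\mathcal L_{\delta,h}^{-1/2}(U-V)\|_{L^2,h}^2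 .$$ If $A_h\ge0$, $B_h\ge0$ and $\tau\le\frac1{3C_h}$, then for all $n\ge0$ $$\tilde E_h(U_\delta^{n+1},U_\delta^n)\le\tilde E_h(U_\delta^n,U_\delta^{n-1}).$$ In particular, if $A_h=B_h=0$, then $$E_h(U_\delta^{n+1})+\left(\frac1{4\tau}+C_h\right)\|U_\delta^{n+1}-U_\delta^n\|_{L^2,h}^2\le E_h(U_\delta^n)+\left(\frac1{4\tau}+C_h\right)\|U_\delta^n-U_\delta^{n-1}\|_{L^2,h}^2 .$$
   Context: Parameters: $\epsilon>0$, $\gamma>0$, $M>0$ and $\omega\in(0,\tfrac12)$ are fixed constants; $A_h,B_h$ are real stabilization constants; $\Omega=[-\pi,\pi)^d$, $|\Omega|=(2\pi)^d$. $W(s)=18(s-s^2)^2$ for $|s|\le M_{\rm cut}$, and for $|s|>M_{\rm cut}$ it is replaced by its $C^2$ quadratic extension (second-order Taylor polynomial at $\pm M_{\rm cut}$), where $M_{\rm cut}>0$ is a fixed constant; $L_{W''}:=\|W''\|_{L^\infty}<\infty$. Kernel: $\rho:(0,\infty)\to[0,\infty)$ is a fixed nonnegative, nonincreasing function supported in $[0,1]$ with $\int_0^1\rho(r)r^{d+1}\,dr=2d/S_d$, where $S_d$ is the area of the unit sphere in $\mathbb R^d$ ($S_1=2$); $\rho_\delta(r)=\delta^{-(d+2)}\rho(r/\delta)$. The Fourier symbol is $\lambda_\delta(\mathbf k)=\int_{|\mathbf s|\le\delta}\rho_\delta(|\mathbf s|)(1-\cos(\mathbf k\cdot\mathbf s))\,d\mathbf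 s$ for $\mathbf k\in\mathbb Z^d$. Discretization: $N$ is a positive even integer, $h=2\pi/N$, grid points $\mathbf x_{\mathbf j}=-\pi\mathbf 1_d+h\mathbf j$ with $\mathbf j\in S_h=\{1,\dots,N\}^d$; $\mathcal M_h$ is the space of real-valued periodic grid functions, $\langle f,g\rangle_h=h^d\sum_{\mathbf j\in S_h}f_{\mathbf j}g_{\mathbf j}$, $\|f\|_{L^2,h}=\langle f,f\rangle_h^{1/2}$. Discrete Fourier coefficients: $\hat f_{\mathbf k}=N^{-d}\sum_{\mathbf j\in S_h}f_{\mathbf j}e^{-i\mathbf k\cdot\mathbf x_{\mathbf j}}$, $\mathbf k\in\hat S_h=\{-N/2+1,\dots,N/2\}^d$. For an exponent $p\in\{1,-1,-\tfrac12\}$, $(\mathcal L_{\delta,h}^{p}f)_{\mathbf j}=\sum_{\mathbf 0\ne\mathbf k\in\hat S_h}\lambda_\delta(\mathbf k)^{p}\hat f_{\mathbf k}e^{i\mathbf k\cdot\mathbf x_{\mathbf j}}$ (so negative powers are applied after subtracting the mean). $\|\mathcal L_{\delta,h}^{-1}\|_{L^2,h}$ is the operator norm of $\mathcal L_{\delta,h}^{-1}$ with respect to $\|\cdot\|_{L^2,h}$. $W$ and $W'$ act pointwise on grid functions; constants are identified with constant grid functions. *)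

theory Defs
  imports "HOL-Analysis.Analysis" "HOL-Probability.Essential_Supremum"
begin

text \<open>
  The dimension \<open>d\<close> is \<open>CARD('d)\<close>. Multi-indices and wave vectors are
  elements of \<open>int ^ 'd\<close>; a grid function assigns a value to every index in
  \<open>int ^ 'd\<close> and is \<open>N\<close>-periodic in each coordinate.
\<close>

subsection \<open>Double-well potential\<close>

definition W_poly :: "real \<Rightarrow> real" where
  "W_poly s = 18 * (s - s\<^sup>2)\<^sup>2"

definition taylor2 :: "(real \<Rightarrow> real) \<Rightarrow> real \<Rightarrow> real \<Rightarrow> real" where
  "taylor2 f a s = f a + deriv f a * (s - a) + deriv (deriv f) a / 2 * (s - a)\<^sup>2"

definition W :: "real \<Rightarrow> real \<Rightarrow> real" where
  "W Mcut s = (if \<bar>s\<bar> \<le> Mcut then W_poly s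
               else if s > Mcut then taylor2 W_poly Mcut s
               else taylor2 W_poly (- Mcut) s)"

definition LW2 :: "real \<Rightarrow> real" where
  "LW2 Mcut = real_of_ereal (esssup lborel (\<lambda>s. ereal \<bar>deriv (deriv (W Mcut)) s\<bar>))"

subsection \<open>Nonlocal kernel and Fourier symbol\<close>

text \<open>Area of the unit sphere in \<open>\<real>\<^sup>d\<close>, via the closed form
  \<open>2 \<pi>\<^bsup>d/2\<^esup> / \<Gamma>(d/2)\<close>; for \<open>d = 1\<close> it is the number of endpoints.\<close>

definition sphere_area :: "nat \<Rightarrow> real" where
  "sphere_area d = 2 * pi powr (real d / 2) / Gamma (real d / 2)"

lemma sphere_area_eq: "d > 0 \<Longrightarrow> sphere_area d = real d * unit_ball_vol (real d)"
  using Gamma_plus1[of "real d / 2"]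
  by (auto simp: sphere_area_def unit_ball_vol_def field_simps Gamma_eq_zero_iff nonpos_Ints_def)

lemma sphere_area_1: "sphere_area 1 = 2"
  using sphere_area_eq[of 1] by simp

lemma sphere_area_2: "sphere_area 2 = 2 * pi"
  using sphere_area_eq[of 2] by (simp add: unit_ball_vol_2)

lemma sphere_area_3: "sphere_area 3 = 4 * pi"
  using sphere_area_eq[of 3] by (simp add: unit_ball_vol_3)

text \<open>Only the values of \<open>\<rho>\<close> on \<open>(0,\<infinity>)\<close> matter. The moment is nonzero, so
  the last condition includes integrability.\<close>

definition admissible_kernel :: "nat \<Rightarrow> (real \<Rightarrow> real) \<Rightarrow> bool" where
  "admissible_kernel d \<rho> \<longleftrightarrow>
     (\<forall>r>0. \<rho> r \<ge> 0) \<and>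
     antimono_on {0<..} \<rho> \<and>
     (\<forall>r>1. \<rho> r = 0) \<and>
     (LINT r:{0<..1}|lborel. \<rho> r * r ^ (d + 1)) = 2 * real d / sphere_area d"

definition scaled_kernel :: "nat \<Rightarrow> (real \<Rightarrow> real) \<Rightarrow> real \<Rightarrow> real \<Rightarrow> real" where
  "scaled_kernel d \<rho> \<delta> r = \<rho> (r / \<delta>) / \<delta> ^ (d + 2)"

definition real_vec :: "int ^ 'd \<Rightarrow> real ^ 'd::finite" where
  "real_vec k = (\<chi> i. real_of_int (k $ i))"

definition symb :: "(real \<Rightarrow> real) \<Rightarrow> real \<Rightarrow> int ^ 'd::finite \<Rightarrow> real" where
  "symb \<rho> \<delta> k =
     (LINT s:cball (0 :: real ^ 'd) \<delta>|lborel.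
        scaled_kernel CARD('d) \<rho> \<delta> (norm s) * (1 - cos (real_vec k \<bullet> s)))"

subsection \<open>Grid functions\<close>

definition mesh :: "nat \<Rightarrow> real" where
  "mesh N = 2 * pi / real N"

definition gridpt :: "nat \<Rightarrow> int ^ 'd \<Rightarrow> real ^ 'd::finite" where
  "gridpt N j = (\<chi> i. - pi + mesh N * real_of_int (j $ i))"

definition Sh :: "nat \<Rightarrow> (int ^ 'd::finite) set" where
  "Sh N = {j. \<forall>i. 1 \<le> j $ i \<and> j $ i \<le> int N}"

definition Shat :: "nat \<Rightarrow> (int ^ 'd::finite) set" where
  "Shat N = {k. \<forall>i. - (int N div 2) + 1 \<le> k $ i \<and> k $ i \<le> int N div 2}"

type_synonym 'd gridfun = "int ^ 'd \<Rightarrow> real"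

definition Mh :: "nat \<Rightarrow> 'd::finite gridfun set" where
  "Mh N = {f. \<forall>j i. f (j + axis i (int N)) = f j}"

definition inner_h :: "nat \<Rightarrow> 'd::finite gridfun \<Rightarrow> 'd gridfun \<Rightarrow> real" where
  "inner_h N f g = mesh N ^ CARD('d) * (\<Sum>j\<in>Sh N. f j * g j)"

definition norm_h :: "nat \<Rightarrow> 'd::finite gridfun \<Rightarrow> real" where
  "norm_h N f = sqrt (inner_h N f f)"

definition dft :: "nat \<Rightarrow> 'd::finite gridfun \<Rightarrow> int ^ 'd \<Rightarrow> complex" where
  "dft N f k = (\<Sum>j\<in>Sh N. of_real (f j) * cis (- (real_vec k \<bullet> gridpt N j)))
                / of_nat N ^ CARD('d)"

subsection \<open>Discrete nonlocal operator and its powers\<close>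

definition Lh_sum :: "(real \<Rightarrow> real) \<Rightarrow> real \<Rightarrow> nat \<Rightarrow> real \<Rightarrow> 'd::finite gridfun \<Rightarrow> int ^ 'd \<Rightarrow> complex"
  where
  "Lh_sum \<rho> \<delta> N p f j =
     (\<Sum>k\<in>Shat N - {0}. of_real (symb \<rho> \<delta> k powr p) * dft N f k
                         * cis (real_vec k \<bullet> gridpt N j))"

text \<open>For even \<open>N\<close> the spectral sum is real (lemma \<open>Lh_sum_real\<close> below), so
  taking the real part is only a change of type.\<close>

definition Lh :: "(real \<Rightarrow> real) \<Rightarrow> real \<Rightarrow> nat \<Rightarrow> real \<Rightarrow> 'd::finite gridfun \<Rightarrow> 'd gridfun"
  where
  "Lh \<rho> \<delta> N p f j = Re (Lh_sum \<rho> \<delta> N p f j)"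

definition opnorm_h :: "nat \<Rightarrow> ('d::finite gridfun \<Rightarrow> 'd gridfun) \<Rightarrow> real" where
  "opnorm_h N T = (SUP f\<in>{f \<in> Mh N. norm_h N f \<le> 1}. norm_h N (T f))"

lemma symb_reflect:
  fixes k k' :: "int ^ 'd::finite"
  assumes "\<And>i. k' $ i = k $ i \<or> k' $ i = - (k $ i)"
  shows "symb \<rho> \<delta> k' = symb \<rho> \<delta> k"
proof -
  define \<sigma> :: "'d \<Rightarrow> real" where "\<sigma> i = (if k' $ i = k $ i then 1 else -1)" for i
  define c :: "real ^ 'd \<Rightarrow> real" where "c b = (\<Sum>i\<in>UNIV. \<sigma> i * b $ i)" for b
  define T :: "real ^ 'd \<Rightarrow> real ^ 'd" where "T x = 0 + (\<Sum>b\<in>Basis. (c b * (x \<bullet> b)) *\<^sub>R b)" for x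
  have \<sigma>sq: "\<sigma> i * \<sigma> i = 1" for i by (simp add: \<sigma>_def)
  have k': "real_of_int (k' $ i) = \<sigma> i * real_of_int (k $ i)" for i
    using assms[of i] by (auto simp: \<sigma>_def)
  have caxis: "c (axis i 1) = \<sigma> i" for i
    by (simp add: c_def axis_def if_distrib[of "\<lambda>x. _ * x"] cong: if_cong)
  have T: "T x $ i = \<sigma> i * x $ i" for x i
  proof -
    have "T x $ i = T x \<bullet> axis i 1"
      by (simp add: inner_axis)
    also have "\<dots> = (\<Sum>b\<in>Basis. (c b * (x \<bullet> b)) * (b \<bullet> axis i 1))"
      by (simp add: T_def inner_sum_left)
    also have "\<dots> = (\<Sum>b\<in>Basis. if b = axis i 1 then c b * (x \<bullet> b) else 0)"
      by (rule sum.cong) (auto simp: inner_Basis axis_in_Basis_iff)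
    also have "\<dots> = \<sigma> i * x $ i"
      by (simp add: caxis inner_axis axis_in_Basis_iff)
    finally show ?thesis .
  qed
  have cb: "\<bar>c b\<bar> = 1" if "b \<in> Basis" for b
  proof -
    from that obtain i where "b = axis i 1" by (auto simp: Basis_vec_def)
    thus ?thesis by (simp add: caxis \<sigma>_def)
  qed
  have "(lborel :: (real ^ 'd) measure) = density (distr lborel borel T) (\<lambda>_. (\<Prod>b\<in>Basis. \<bar>c b\<bar>))"
    unfolding T_def by (rule lborel_affine_euclidean) (use cb in force)
  also have "\<dots> = distr lborel borel T"
    using cb by (simp add: density_1 cong: prod.cong)
  finally have L: "(lborel :: (real ^ 'd) measure) = distr lborel borel T" .
  have inner: "x \<bullet> y = (\<Sum>i\<in>UNIV. x $ i * y $ i)" for x y :: "real ^ 'd"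
    by (simp add: inner_vec_def)
  have Tm: "T \<in> borel \<rightarrow>\<^sub>M borel"
    unfolding T_def by measurable
  have TT: "T (T x) = x" for x
    by (simp add: vec_eq_iff T \<sigma>sq flip: mult.assoc)
  have normT: "norm (T x) = norm x" for x
    unfolding norm_eq_sqrt_inner inner T
    by (intro arg_cong[of _ _ sqrt] sum.cong) (auto simp: \<sigma>_def)
  have kT: "real_vec k \<bullet> T x = real_vec k' \<bullet> x" for x
    by (simp add: inner T real_vec_def k' mult_ac)
  define F where "F s = indicator (cball (0 :: real ^ 'd) \<delta>) s *
     (scaled_kernel CARD('d) \<rho> \<delta> (norm s) * (1 - cos (real_vec k \<bullet> s)))" for s
  have "symb \<rho> \<delta> k = (LINT s|lborel. F s)"
    by (simp add: symb_def set_lebesgue_integral_def F_def)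
  also have "\<dots> = (LINT s|distr lborel borel T. F s)" using L by simp
  also have "\<dots> = (LINT s|lborel. F (T s))"
  proof (cases "F \<in> borel_measurable borel")
    case True
    then show ?thesis using Tm by (subst integral_distr) auto
  next
    case False
    have "(\<lambda>s. F (T s)) \<notin> borel_measurable borel"
    proof
      assume "(\<lambda>s. F (T s)) \<in> borel_measurable borel"
      from measurable_compose[OF Tm this] show False using False by (simp add: TT)
    qed
    with False have "\<not> integrable lborel F" "\<not> integrable lborel (\<lambda>s. F (T s))"
      by (auto dest: borel_measurable_integrable)
    then show ?thesis by (simp add: not_integrable_integral_eq flip: L)
  qed
  also have "\<dots> = symb \<rho> \<delta> k'"
    by (simp add: symb_def set_lebesgue_integral_def F_def normT kT indicator_def)
  finally show ?thesis ..
qed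


lemma Lh_sum_real:
  fixes f :: "'d::finite gridfun"
  assumes "even N" "N > 0"
  shows "Im (Lh_sum \<rho> \<delta> N p f j) = 0"
proof -
  define m where "m = int N div 2"
  have m: "int N = 2 * m" "m > 0" using assms by (auto simp: m_def)
  define \<iota> :: "int ^ 'd \<Rightarrow> int ^ 'd" where "\<iota> k = (\<chi> i. if k $ i = m then m else - (k $ i))" for k
  have \<iota>i: "\<iota> k $ i = (if k $ i = m then m else - (k $ i))" for k i by (simp add: \<iota>_def)
  have bij: "bij_betw \<iota> (Shat N - {0}) (Shat N - {0})"
  proof (rule bij_betw_byWitness[where f' = \<iota>])
    have inv: "\<iota> (\<iota> k) = k" if "k \<in> Shat N" for k
    proof -
      have "- m \<noteq> k $ i" for i
        using that unfolding Shat_def m_def[symmetric] by (auto dest: spec[of _ i])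
      then show ?thesis by (auto simp: vec_eq_iff \<iota>i minus_equation_iff)
    qed
    then show "\<forall>k\<in>Shat N - {0}. \<iota> (\<iota> k) = k" "\<forall>k\<in>Shat N - {0}. \<iota> (\<iota> k) = k" by auto
    have "\<iota> k \<in> Shat N - {0}" if k: "k \<in> Shat N - {0}" for k
    proof -
      have "- m + 1 \<le> k $ i \<and> k $ i \<le> m" for i
        using k by (auto simp: Shat_def m_def)
      then have "- m + 1 \<le> \<iota> k $ i \<and> \<iota> k $ i \<le> m" for i
        using m(2) by (auto simp: \<iota>i) (smt (verit))+
      moreover have "\<iota> k \<noteq> 0"
        using k m(2) by (force simp: vec_eq_iff \<iota>i split: if_splits)
      ultimately show ?thesis by (simp add: Shat_def m_def)
    qed
    then show "\<iota> ` (Shat N - {0}) \<subseteq> Shat N - {0}" "\<iota> ` (Shat N - {0}) \<subseteq> Shat N - {0}" by auto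
  qed
  have cis_\<iota>: "cis (real_vec (\<iota> k) \<bullet> gridpt N l) = cis (- (real_vec k \<bullet> gridpt N l))" for k l
  proof -
    define t :: "'d \<Rightarrow> int" where "t i = (if k $ i = m then l $ i - m else 0)" for i
    have eq: "real_of_int (\<iota> k $ i) * (- pi + mesh N * l $ i)
            = - (real_of_int (k $ i) * (- pi + mesh N * l $ i)) + 2 * pi * real_of_int (t i)" for i
    proof -
      have "real N = 2 * real_of_int m" using m(1) by (metis of_int_mult of_int_numeral of_int_of_nat_eq)
      then show ?thesis using m(2) by (simp add: \<iota>i t_def mesh_def field_simps)
    qed
    have "real_vec (\<iota> k) \<bullet> gridpt N l
            = - (real_vec k \<bullet> gridpt N l) + 2 * pi * real_of_int (\<Sum>i\<in>UNIV. t i)"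
      unfolding inner_vec_def real_vec_def gridpt_def vec_lambda_beta inner_real_def eq sum.distrib
      by (simp add: sum_negf flip: sum_distrib_left)
    moreover have "cis (2 * pi * real_of_int z) = 1" for z
      by (rule cis_multiple_2pi) simp
    ultimately show ?thesis by (simp only: cis_mult[symmetric] mult_1_right)
  qed
  have symb_\<iota>: "symb \<rho> \<delta> (\<iota> k) = symb \<rho> \<delta> k" for k
    by (rule symb_reflect) (auto simp: \<iota>i)
  have cis_\<iota>': "cis (- (real_vec (\<iota> k) \<bullet> gridpt N l)) = cis (real_vec k \<bullet> gridpt N l)" for k l
    using arg_cong[OF cis_\<iota>[of k l], of cnj] by (simp add: cis_cnj)
  have dft_\<iota>: "dft N f (\<iota> k) = cnj (dft N f k)" for k
    by (simp add: dft_def cis_\<iota>' cis_cnj)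
  have "cnj (Lh_sum \<rho> \<delta> N p f j)
      = (\<Sum>k\<in>Shat N - {0}. of_real (symb \<rho> \<delta> (\<iota> k) powr p) * dft N f (\<iota> k)
                            * cis (real_vec (\<iota> k) \<bullet> gridpt N j))"
    by (simp add: Lh_sum_def symb_\<iota> dft_\<iota> cis_\<iota> cis_cnj)
  also have "\<dots> = Lh_sum \<rho> \<delta> N p f j"
    unfolding Lh_sum_def by (rule sum.reindex_bij_betw[OF bij])
  finally show ?thesis by (simp add: complex_eq_iff)
qed

subsection \<open>Energies and the time-stepping scheme\<close>

definition vol_dom :: "'d::finite itself \<Rightarrow> real" where
  "vol_dom _ = (2 * pi) ^ CARD('d)"

definition Ch ::
  "'d::finite itself \<Rightarrow> real \<Rightarrow> real \<Rightarrow> real \<Rightarrow> real \<Rightarrow> (real \<Rightarrow> real) \<Rightarrow> real \<Rightarrow> nat \<Rightarrow> real"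
  where
  "Ch d \<epsilon> \<gamma> M Mcut \<rho> \<delta> N =
     LW2 Mcut / (2 * \<epsilon>)
     + \<gamma> / 2 * opnorm_h N (Lh \<rho> \<delta> N (-1) :: 'd gridfun \<Rightarrow> 'd gridfun)
     + M / 2 * vol_dom d"

definition Eh ::
  "real \<Rightarrow> real \<Rightarrow> real \<Rightarrow> real \<Rightarrow> real \<Rightarrow> (real \<Rightarrow> real) \<Rightarrow> real \<Rightarrow> nat \<Rightarrow> 'd::finite gridfun \<Rightarrow> real"
  where
  "Eh \<epsilon> \<gamma> M \<omega> Mcut \<rho> \<delta> N U =
     \<epsilon> / 2 * inner_h N (Lh \<rho> \<delta> N 1 U) U
     + 1 / \<epsilon> * inner_h N (\<lambda>j. W Mcut (U j)) (\<lambda>_. 1)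
     + \<gamma> / 2 * inner_h N (Lh \<rho> \<delta> N (-1) (\<lambda>j. U j - \<omega>)) (\<lambda>j. U j - \<omega>)
     + M / 2 * (inner_h N (\<lambda>j. U j - \<omega>) (\<lambda>_. 1))\<^sup>2"

definition Eh_mod ::
  "real \<Rightarrow> real \<Rightarrow> real \<Rightarrow> real \<Rightarrow> real \<Rightarrow> (real \<Rightarrow> real) \<Rightarrow> real \<Rightarrow> nat \<Rightarrow> real \<Rightarrow> real \<Rightarrow> real \<Rightarrow>
   'd::finite gridfun \<Rightarrow> 'd gridfun \<Rightarrow> real"
  where
  "Eh_mod \<epsilon> \<gamma> M \<omega> Mcut \<rho> \<delta> N A B \<tau> U V =
     Eh \<epsilon> \<gamma> M \<omega> Mcut \<rho> \<delta> N U
     + (A / 2 + 1 / (4 * \<tau>) + Ch TYPE('d) \<epsilon> \<gamma> M Mcut \<rho> \<delta> N) * (norm_h N (\<lambda>j. U j - V j))\<^sup>2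
     + \<gamma> * B / 2 * (norm_h N (Lh \<rho> \<delta> N (-1/2) (\<lambda>j. U j - V j)))\<^sup>2"

text \<open>One step \<open>(U\<^bsup>n-1\<^esup>, U\<^bsup>n\<^esup>) \<mapsto> U\<^bsup>n+1\<^esup>\<close>, written \<open>(Um, U, Up)\<close>.\<close>

definition bdf2_step ::
  "real \<Rightarrow> real \<Rightarrow> real \<Rightarrow> real \<Rightarrow> real \<Rightarrow> (real \<Rightarrow> real) \<Rightarrow> real \<Rightarrow> nat \<Rightarrow> real \<Rightarrow> real \<Rightarrow> real \<Rightarrow>
   'd::finite gridfun \<Rightarrow> 'd gridfun \<Rightarrow> 'd gridfun \<Rightarrow> bool"
  where
  "bdf2_step \<epsilon> \<gamma> M \<omega> Mcut \<rho> \<delta> N A B \<tau> Um U Up \<longleftrightarrow>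
     (\<forall>j. (3 * Up j - 4 * U j + Um j) / (2 * \<tau>) =
        - \<epsilon> * Lh \<rho> \<delta> N 1 Up j
        - 1 / \<epsilon> * (2 * deriv (W Mcut) (U j) - deriv (W Mcut) (Um j))
        - \<gamma> * B * Lh \<rho> \<delta> N (-1) (\<lambda>i. Up i - 2 * U i + Um i) j
        - A * (Up j - 2 * U j + Um j)
        - \<gamma> * Lh \<rho> \<delta> N (-1) (\<lambda>i. 2 * U i - Um i - \<omega>) j
        - M * (inner_h N (\<lambda>i. 2 * U i - Um i) (\<lambda>_. 1) - \<omega> * vol_dom TYPE('d)))"

end

theory Submission
  imports Defs
begin

text \<open>
  Write \<open>p, u, v\<close> for three consecutive iterates \<open>U\<^bsup>n+1\<^esup>, U\<^bsup>n\<^esup>, U\<^bsup>n-1\<^esup>\<close>. The scheme is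
  tested with the increment \<open>p - u\<close>, and every term is compared with the change of one part of
  the energy. Except for the potential, each term has the form \<open>b (\<dots>) (p - u)\<close> with a symmetric
  positive semidefinite bilinear form \<open>b\<close>: the grid inner product, \<open>\<langle>L\<^bsup>q\<^esup> f, g\<rangle>\<close> for a power of
  the nonlocal operator, or the product of the masses of \<open>f\<close> and \<open>g\<close>. For such a form polarisation
  gives four inequalities, one for each role that it plays in the scheme: implicit term,
  extrapolated term, stabilising term and backward difference. They are proved once, in the locale
  \<open>nonneg_symmetric_form\<close>.

  An extrapolated term costs a multiple of
  \<open>2 |p - u|\<^sup>2 + |u - v|\<^sup>2\<close>; the three multiples, from the potential, the operator
  \<open>L\<^bsup>-1\<^esup>\<close> and the mass, add up to the constant \<open>C\<close> of the theorem. The backward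
  difference yields \<open>|p - u|\<^sup>2 / \<tau> + (|p - u|\<^sup>2 - |u - v|\<^sup>2) / (4 \<tau>)\<close>. With
  \<open>C (|p - u|\<^sup>2 - |u - v|\<^sup>2)\<close> included in the modified energy, the total change is at most
  \<open>(3 C - 1 / \<tau>) |p - u|\<^sup>2\<close>, which is nonpositive under the step size restriction.

  Three facts from analysis enter. The potential is \<open>C\<^sup>2\<close> with second derivative bounded
  everywhere by its essential supremum, so that \<open>W\<close> and \<open>W'\<close> satisfy the usual Taylor
  estimates (\<open>W_extrapolated_le\<close>). The operators are diagonal in the discrete Fourier basis with
  nonnegative multipliers, so that they give positive forms, and \<open>|L\<^bsup>-1/2\<^esup> f|\<^sup>2 =
  \<langle>L\<^bsup>-1\<^esup> f, f\<rangle>\<close> by orthogonality of the characters (\<open>norm_Lh_half\<close>). Finally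
  \<open>\<langle>L\<^bsup>-1\<^esup> f, f\<rangle>\<close> is bounded by the operator norm, which is a finite supremum because the
  grid is finite (\<open>inner_Lh_le_opnorm\<close>).
\<close>

section \<open>Derivatives of the potential\<close>

lemma has_real_derivative_glue:
  fixes f g f' g' :: "real \<Rightarrow> real"
  assumes f: "\<And>s. (f has_real_derivative f' s) (at s)"
    and g: "\<And>s. (g has_real_derivative g' s) (at s)"
    and eq: "f a = g a" "f' a = g' a"
  shows "((\<lambda>s. if s \<le> a then f s else g s) has_real_derivative (if s \<le> a then f' s else g' s)) (at s)"
proof -
  let ?h = "\<lambda>s. if s \<in> {..a} then f s else g s"
  have UN: "(UNIV :: real set) = {..a} \<union> {a..}" by auto
  have "(?h has_vector_derivative (if s \<in> {..a} then f' s else g' s)) (at s within UNIV)"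
    by (rule has_vector_derivative_If_within_closures[where T = "{a..}"])
       (use f g eq UN in \<open>auto simp flip: has_real_derivative_iff_has_vector_derivative
         intro: has_field_derivative_at_within antisym\<close>)
  then show ?thesis
    by (simp flip: has_real_derivative_iff_has_vector_derivative)
qed

definition W_poly_deriv :: "real \<Rightarrow> real" where
  "W_poly_deriv s = 36 * (s - s\<^sup>2) * (1 - 2 * s)"

definition W_poly_deriv2 :: "real \<Rightarrow> real" where
  "W_poly_deriv2 s = 36 * ((1 - 2 * s)\<^sup>2 - 2 * (s - s\<^sup>2))"

lemma W_poly_has_derivatives:
  "(W_poly has_real_derivative W_poly_deriv s) (at s)"
  "(W_poly_deriv has_real_derivative W_poly_deriv2 s) (at s)"
  unfolding W_poly_def [abs_def] W_poly_deriv_def [abs_def] W_poly_deriv2_def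
  by (auto intro!: derivative_eq_intros simp: power2_eq_square algebra_simps)

lemma taylor2_W_poly:
  "taylor2 W_poly a s = W_poly a + W_poly_deriv a * (s - a) + W_poly_deriv2 a / 2 * (s - a)\<^sup>2"
proof -
  have "deriv W_poly = W_poly_deriv" "deriv W_poly_deriv = W_poly_deriv2"
    using W_poly_has_derivatives DERIV_imp_deriv by blast+
  then show ?thesis by (simp add: taylor2_def)
qed

definition W_deriv :: "real \<Rightarrow> real \<Rightarrow> real" where
  "W_deriv c s = (if s \<le> c then if s \<le> - c then W_poly_deriv (- c) + W_poly_deriv2 (- c) * (s + c)
               else W_poly_deriv s
             else W_poly_deriv c + W_poly_deriv2 c * (s - c))"

text \<open>
  Outside \<open>[-c, c]\<close> the extended potential is quadratic, so its second derivative is that of the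
  polynomial at the nearest point of \<open>[-c, c]\<close>. In this clamped form continuity and boundedness
  are visible.
\<close>
definition W_deriv2 :: "real \<Rightarrow> real \<Rightarrow> real" where
  "W_deriv2 c s = W_poly_deriv2 (max (- c) (min c s))"

text \<open>
  The definition of \<open>W\<close> is rewritten as two nested gluings, at \<open>-c\<close> and at \<open>c\<close>; the Taylor
  polynomial agrees with \<open>W_poly\<close> to second order at the gluing point.
\<close>
lemma W_has_derivative:
  assumes c: "c > 0"
  shows "(W c has_real_derivative W_deriv c s) (at s)"
proof -
  have W: "W c = (\<lambda>s. if s \<le> c then if s \<le> - c then taylor2 W_poly (- c) s else W_poly s
                       else taylor2 W_poly c s)"
  proof
    fix s
    \<comment> \<open>At \<open>s = - c\<close> the two descriptions use different branches, whose values agree there.\<close>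
    show "W c s = (if s \<le> c then if s \<le> - c then taylor2 W_poly (- c) s else W_poly s
                   else taylor2 W_poly c s)"
      using c by (cases "s = - c") (auto simp: W_def taylor2_W_poly)
  qed
  have T: "(taylor2 W_poly a has_real_derivative W_poly_deriv a + W_poly_deriv2 a * (s - a)) (at s)" for a s
    unfolding taylor2_W_poly [abs_def]
    by (auto intro!: derivative_eq_intros simp: field_simps)
  have inner: "((\<lambda>s. if s \<le> - c then taylor2 W_poly (- c) s else W_poly s) has_real_derivative
      (if s \<le> - c then W_poly_deriv (- c) + W_poly_deriv2 (- c) * (s - - c) else W_poly_deriv s)) (at s)" for s
    by (rule has_real_derivative_glue) (use T[of "- c"] W_poly_has_derivatives in \<open>auto simp: taylor2_W_poly [abs_def]\<close>)
  have "(W c has_real_derivative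
      (if s \<le> c then if s \<le> - c then W_poly_deriv (- c) + W_poly_deriv2 (- c) * (s - - c) else W_poly_deriv s
       else W_poly_deriv c + W_poly_deriv2 c * (s - c))) (at s)"
    unfolding W by (rule has_real_derivative_glue) (use T[of c] inner c in \<open>auto simp: taylor2_W_poly [abs_def]\<close>)
  then show ?thesis by (simp add: W_deriv_def cong: if_cong)
qed

lemma W_deriv_has_derivative:
  assumes c: "c > 0"
  shows "(W_deriv c has_real_derivative W_deriv2 c s) (at s)"
proof -
  have T: "((\<lambda>s. W_poly_deriv a + W_poly_deriv2 a * (s - a)) has_real_derivative W_poly_deriv2 a) (at s)" for a s
    by (auto intro!: derivative_eq_intros)
  have inner: "((\<lambda>s. if s \<le> - c then W_poly_deriv (- c) + W_poly_deriv2 (- c) * (s - - c) else W_poly_deriv s)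
      has_real_derivative (if s \<le> - c then W_poly_deriv2 (- c) else W_poly_deriv2 s)) (at s)" for s
    by (rule has_real_derivative_glue) (use T[of "- c"] W_poly_has_derivatives in auto)
  have "((\<lambda>s. if s \<le> c then if s \<le> - c then W_poly_deriv (- c) + W_poly_deriv2 (- c) * (s - - c) else W_poly_deriv s
             else W_poly_deriv c + W_poly_deriv2 c * (s - c)) has_real_derivative
      (if s \<le> c then if s \<le> - c then W_poly_deriv2 (- c) else W_poly_deriv2 s else W_poly_deriv2 c)) (at s)"
    by (rule has_real_derivative_glue) (use T[of c] inner c in auto)
  moreover have "(if s \<le> c then if s \<le> - c then W_poly_deriv2 (- c) else W_poly_deriv2 s else W_poly_deriv2 c) = W_deriv2 c s"
    using c by (auto simp: W_deriv2_def max_def min_def)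
  ultimately show ?thesis by (simp add: W_deriv_def [abs_def] cong: if_cong)
qed

lemma deriv_W:
  assumes "c > 0"
  shows "deriv (W c) = W_deriv c" "deriv (W_deriv c) = W_deriv2 c"
  using W_has_derivative[OF assms] W_deriv_has_derivative[OF assms] DERIV_imp_deriv by blast+

text \<open>
  \<open>LW2\<close> is an essential supremum, but the second derivative is continuous, so the set where the
  bound holds is closed and of full measure, hence everything. Boundedness of the second derivative
  is needed first: \<open>LW2\<close> passes from the extended reals to the reals, where an infinite value
  would become 0.
\<close>
lemma abs_W_deriv2_le_LW2:
  assumes c: "c > 0"
  shows "\<bar>W_deriv2 c s\<bar> \<le> LW2 c"
proof -
  have cont: "continuous_on UNIV (W_deriv2 c)"
    unfolding W_deriv2_def [abs_def] W_poly_deriv2_def by (intro continuous_intros)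
  have "compact (W_poly_deriv2 ` {- c..c})"
    by (intro compact_continuous_image)
       (auto simp: W_poly_deriv2_def [abs_def] intro!: continuous_intros)
  then obtain K where K: "\<And>x. x \<in> {- c..c} \<Longrightarrow> \<bar>W_poly_deriv2 x\<bar> \<le> K"
    by (force dest!: compact_imp_bounded simp: bounded_iff)
  let ?f = "\<lambda>s. ereal \<bar>W_deriv2 c s\<bar>"
  have meas: "?f \<in> borel_measurable lborel"
    using borel_measurable_continuous_onI[OF cont] by measurable
  have "\<bar>W_deriv2 c s\<bar> \<le> K" for s
    using c by (auto simp: W_deriv2_def intro!: K)
  then have le: "esssup lborel ?f \<le> ereal K"
    using meas by (intro esssup_I) auto
  have AE: "AE s in lborel. ?f s \<le> esssup lborel ?f"
    by (rule esssup_AE)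
  have "esssup lborel (\<lambda>_::real. 0::ereal) \<le> esssup lborel ?f"
    by (rule esssup_mono) auto
  then have ge: "0 \<le> esssup lborel ?f"
    by (subst (asm) esssup_const) auto
  have fin: "esssup lborel ?f = ereal (LW2 c)"
    unfolding LW2_def deriv_W[OF c] using le ge
    by (cases "esssup lborel ?f") auto
  have closed: "closed {s. \<bar>W_deriv2 c s\<bar> \<le> LW2 c}"
    by (intro closed_Collect_le continuous_intros cont)
  have "AE s in lborel. s \<in> {s. \<bar>W_deriv2 c s\<bar> \<le> LW2 c}"
    using AE unfolding fin by simp
  then have "s \<in> {s. \<bar>W_deriv2 c s\<bar> \<le> LW2 c}"
    using closed by (intro mem_closed_if_AE_lebesgue) (auto intro: AE_completion)
  then show ?thesis by simp
qed

lemma W_taylor_le: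
  assumes c: "c > 0"
  shows "W c p \<le> W c u + W_deriv c u * (p - u) + LW2 c / 2 * (p - u)\<^sup>2"
proof (cases "p = u")
  case False
  define D where "D m = (if m = 0 then W c else if m = 1 then W_deriv c else W_deriv2 c)" for m :: nat
  have "\<exists>t. (if p < u then p < t \<and> t < u else u < t \<and> t < p) \<and>
      W c p = (\<Sum>m<2. D m u / fact m * (p - u) ^ m) + D 2 t / fact 2 * (p - u) ^ 2"
    by (rule Taylor[where a = "min p u" and b = "max p u"])
       (use False W_has_derivative[OF c] W_deriv_has_derivative[OF c] in
         \<open>auto simp: D_def less_2_cases_iff\<close>)
  then obtain t where t: "W c p = W c u + W_deriv c u * (p - u) + W_deriv2 c t / 2 * (p - u)\<^sup>2"
    by (auto simp: D_def numeral_2_eq_2)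
  have "W_deriv2 c t / 2 * (p - u)\<^sup>2 \<le> LW2 c / 2 * (p - u)\<^sup>2"
    using abs_W_deriv2_le_LW2[OF c, of t] by (intro mult_right_mono) auto
  with t show ?thesis by simp
qed simp

lemma W_deriv_lipschitz:
  assumes c: "c > 0"
  shows "\<bar>W_deriv c u - W_deriv c v\<bar> \<le> LW2 c * \<bar>u - v\<bar>"
  using field_differentiable_bound[of UNIV "W_deriv c" "W_deriv2 c" "LW2 c" u v]
    W_deriv_has_derivative[OF c] abs_W_deriv2_le_LW2[OF c] by auto

text \<open>
  The difference \<open>2 W'(u) - W'(v) = W'(u) + (W'(u) - W'(v))\<close> splits into a part handled by
  Taylor's formula and a part handled by the Lipschitz bound on \<open>W'\<close> and Young's inequality.
\<close>
lemma W_extrapolated_le: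
  assumes c: "c > 0"
  shows "- (2 * deriv (W c) u - deriv (W c) v) * (p - u)
     \<le> W c u - W c p + LW2 c / 2 * (p - u)\<^sup>2 + LW2 c / 2 * ((p - u)\<^sup>2 + (u - v)\<^sup>2)"
proof -
  have L: "0 \<le> LW2 c" using abs_W_deriv2_le_LW2[OF c, of 0] by linarith
  have "- (W_deriv c u - W_deriv c v) * (p - u) \<le> \<bar>W_deriv c u - W_deriv c v\<bar> * \<bar>p - u\<bar>"
    by (metis abs_ge_self abs_minus_cancel abs_mult)
  also have "\<dots> \<le> LW2 c * (\<bar>u - v\<bar> * \<bar>p - u\<bar>)"
    using mult_right_mono[OF W_deriv_lipschitz[OF c, of u v], of "\<bar>p - u\<bar>"] by (simp add: mult.assoc)
  also have "\<dots> \<le> LW2 c * (((p - u)\<^sup>2 + (u - v)\<^sup>2) / 2)"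
    using L sum_squares_bound[of "\<bar>u - v\<bar>" "\<bar>p - u\<bar>"]
    by (intro mult_left_mono) auto
  finally show ?thesis
    using W_taylor_le[OF c, of p u] unfolding deriv_W[OF c] by (simp add: algebra_simps)
qed

section \<open>Orthogonality of characters on the grid\<close>

lemma finite_box: "finite {k :: int ^ 'd::finite. \<forall>i. a \<le> k $ i \<and> k $ i \<le> b}"
proof -
  have "{k :: int ^ 'd. \<forall>i. a \<le> k $ i \<and> k $ i \<le> b} \<subseteq> vec_lambda ` (UNIV \<rightarrow>\<^sub>E {a..b})"
  proof
    fix k :: "int ^ 'd" assume "k \<in> {k. \<forall>i. a \<le> k $ i \<and> k $ i \<le> b}"
    then have "vec_nth k \<in> UNIV \<rightarrow>\<^sub>E {a..b}" by auto
    then show "k \<in> vec_lambda ` (UNIV \<rightarrow>\<^sub>E {a..b})"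
      by (metis image_eqI vec_nth_inverse)
  qed
  then show ?thesis by (rule finite_subset) (intro finite_imageI finite_PiE, auto)
qed

lemma card_box: "card {k :: int ^ 'd::finite. \<forall>i. a \<le> k $ i \<and> k $ i \<le> b} = nat (b - a + 1) ^ CARD('d)"
proof -
  have "bij_betw vec_lambda (UNIV \<rightarrow>\<^sub>E {a..b}) {k :: int ^ 'd. \<forall>i. a \<le> k $ i \<and> k $ i \<le> b}"
    by (rule bij_betw_byWitness[where f' = vec_nth]) auto
  from bij_betw_same_card[OF this] show ?thesis
    by (simp add: card_PiE)
qed

lemma finite_Sh [simp]: "finite (Sh N :: (int ^ 'd::finite) set)"
  unfolding Sh_def by (rule finite_box)

lemma finite_Shat [simp]: "finite (Shat N :: (int ^ 'd::finite) set)"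
  unfolding Shat_def by (rule finite_box)

lemma card_Sh: "card (Sh N :: (int ^ 'd::finite) set) = N ^ CARD('d)"
  unfolding Sh_def by (simp add: card_box)

text \<open>
  The shift \<open>j \<mapsto> j + e\<^sub>i\<close> permutes the grid once the indices leaving it at
  \<open>N + 1\<close> are wrapped around to 1.
\<close>
lemma sum_Sh_shift:
  fixes F :: "int ^ 'd::finite \<Rightarrow> complex"
  assumes per: "\<And>j. F (j + axis i (int N)) = F j" and N: "N > 0"
  shows "(\<Sum>j\<in>Sh N. F (j + axis i 1)) = (\<Sum>j\<in>Sh N. F j)"
proof -
  define \<sigma> :: "int ^ 'd \<Rightarrow> int ^ 'd" where
    "\<sigma> j = (if j $ i = int N then j + axis i 1 - axis i (int N) else j + axis i 1)" for j
  define \<sigma>' :: "int ^ 'd \<Rightarrow> int ^ 'd" where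
    "\<sigma>' j = (if j $ i = 1 then j - axis i 1 + axis i (int N) else j - axis i 1)" for j
  have nth: "\<sigma> j $ l = (if l = i then if j $ i = int N then 1 else j $ i + 1 else j $ l)"
            "\<sigma>' j $ l = (if l = i then if j $ i = 1 then int N else j $ i - 1 else j $ l)" for j l
    by (auto simp: \<sigma>_def \<sigma>'_def axis_def)
  have bij: "bij_betw \<sigma> (Sh N) (Sh N)"
  proof (rule bij_betw_byWitness[where f' = \<sigma>'])
    have bounds: "1 \<le> j $ l" "j $ l \<le> int N" if "j \<in> Sh N" for j :: "int ^ 'd" and l
      using that by (auto simp: Sh_def)
    show "\<forall>j\<in>Sh N. \<sigma>' (\<sigma> j) = j" "\<forall>j\<in>Sh N. \<sigma> (\<sigma>' j) = j"
      using bounds(1)[of _ i] bounds(2)[of _ i] by (force simp: vec_eq_iff nth)+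
    have "1 \<le> \<sigma> j $ l \<and> \<sigma> j $ l \<le> int N" "1 \<le> \<sigma>' j $ l \<and> \<sigma>' j $ l \<le> int N"
      if "j \<in> Sh N" for j l
      using bounds[OF that, of l] bounds[OF that, of i] N by (auto simp: nth)
    then show "\<sigma> ` Sh N \<subseteq> Sh N" "\<sigma>' ` Sh N \<subseteq> Sh N"
      by (auto simp: Sh_def)
  qed
  have "F (j + axis i 1) = F (\<sigma> j)" for j
    using per[of "\<sigma> j"] by (auto simp: \<sigma>_def)
  then show ?thesis
    using sum.reindex_bij_betw[OF bij, of F] by simp
qed

text \<open>
  If \<open>k\<close> and \<open>l\<close> differ in coordinate \<open>i\<close>, a shift of the grid in direction \<open>i\<close> multiplies
  the summand by a constant \<open>\<zeta>\<close> and leaves the sum \<open>S\<close> unchanged, so \<open>S = \<zeta> S\<close>. Since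
  \<open>|k\<^sub>i - l\<^sub>i| < N\<close>, the root of unity \<open>\<zeta>\<close> is not 1, and \<open>S\<close> vanishes.
\<close>
lemma cis_orthogonal:
  fixes k l :: "int ^ 'd::finite"
  assumes k: "k \<in> Shat N" and l: "l \<in> Shat N" and N: "N > 0" "even N"
  shows "(\<Sum>j\<in>Sh N. cis (real_vec k \<bullet> gridpt N j) * cis (- (real_vec l \<bullet> gridpt N j)))
         = (if k = l then of_nat N ^ CARD('d) else 0)"
proof (cases "k = l")
  case True
  then show ?thesis by (simp add: cis_mult card_Sh)
next
  case False
  then obtain i where i: "k $ i \<noteq> l $ i" by (auto simp: vec_eq_iff)
  define F :: "int ^ 'd \<Rightarrow> complex" where
    "F j = cis (real_vec k \<bullet> gridpt N j) * cis (- (real_vec l \<bullet> gridpt N j))" for j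
  have grid: "gridpt N (j + axis i z) = gridpt N j + (mesh N * of_int z) *\<^sub>R axis i 1" for j :: "int ^ 'd" and z
    by (auto simp: vec_eq_iff gridpt_def axis_def algebra_simps)
  have shift: "F (j + axis i z) = cis (of_int (k $ i - l $ i) * mesh N * of_int z) * F j" for j z
    unfolding F_def grid
    by (simp add: cis_mult inner_add_right inner_axis real_vec_def algebra_simps)
  have per: "F (j + axis i (int N)) = F j" for j
  proof -
    have "of_int (k $ i - l $ i) * mesh N * of_int (int N) = 2 * pi * of_int (k $ i - l $ i)"
      using N by (simp add: mesh_def)
    then have "cis (of_int (k $ i - l $ i) * mesh N * of_int (int N)) = cis (2 * pi * of_int (k $ i - l $ i))"
      by (rule arg_cong)
    also have "\<dots> = 1" by (rule cis_multiple_2pi) (rule Ints_of_int)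
    finally show ?thesis unfolding shift by simp
  qed
  define \<zeta> where "\<zeta> = cis (of_int (k $ i - l $ i) * mesh N)"
  have "\<zeta> \<noteq> 1"
  proof
    assume "\<zeta> = 1"
    then have "cos (of_int (k $ i - l $ i) * mesh N) = 1"
      by (simp add: \<zeta>_def complex_eq_iff)
    then obtain z where "of_int (k $ i - l $ i) * mesh N = of_int z * (2 * pi)"
      by (auto simp: cos_one_2pi_int)
    then have "(2 * pi) * of_int (k $ i - l $ i) = (2 * pi) * (of_int (z * int N) :: real)"
      using N by (simp add: mesh_def divide_simps mult_ac)
    then have "of_int (k $ i - l $ i) = (of_int (z * int N) :: real)"
      by (simp only: mult_cancel_left) simp
    then have eq: "k $ i - l $ i = z * int N" by linarith
    have "\<bar>k $ i - l $ i\<bar> < int N"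
    proof -
      have "- (int N div 2) + 1 \<le> k $ i" "k $ i \<le> int N div 2"
           "- (int N div 2) + 1 \<le> l $ i" "l $ i \<le> int N div 2"
        using k l by (auto simp: Shat_def)
      then show ?thesis by linarith
    qed
    then have "\<bar>z\<bar> * int N < 1 * int N" by (simp add: eq abs_mult)
    then have "z = 0" using N by (subst (asm) mult_less_cancel_right) auto
    then show False using eq i by simp
  qed
  have "(\<Sum>j\<in>Sh N. F j) = (\<Sum>j\<in>Sh N. F (j + axis i 1))"
    using sum_Sh_shift[of F i N, OF per N(1)] by simp
  also have "\<dots> = \<zeta> * (\<Sum>j\<in>Sh N. F j)"
    unfolding shift by (simp add: \<zeta>_def sum_distrib_left)
  finally have "(1 - \<zeta>) * (\<Sum>j\<in>Sh N. F j) = 0" by (simp add: algebra_simps)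
  then show ?thesis using False \<open>\<zeta> \<noteq> 1\<close> by (simp add: F_def)
qed

section \<open>Spectral form of the nonlocal operator\<close>

lemma mesh_pos: "N > 0 \<Longrightarrow> mesh N > 0"
  by (simp add: mesh_def)

lemma mesh_power: "N > 0 \<Longrightarrow> mesh N ^ d * real N ^ d = (2 * pi) ^ d"
proof -
  assume "N > 0"
  then have "(mesh N * real N) ^ d = (2 * pi) ^ d" by (simp add: mesh_def)
  then show ?thesis by (simp only: power_mult_distrib)
qed

lemma dft_add: "dft N (\<lambda>j. f j + g j) k = dft N f k + dft N g k"
  by (simp add: dft_def sum.distrib distrib_right add_divide_distrib)

lemma dft_scale: "dft N (\<lambda>j. a * f j) k = of_real a * dft N f k"
  by (simp add: dft_def sum_distrib_left mult.assoc)

lemma Lh_add: "Lh \<rho> \<delta> N p (\<lambda>j. f j + g j) i = Lh \<rho> \<delta> N p f i + Lh \<rho> \<delta> N p g i"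
  by (simp add: Lh_def Lh_sum_def dft_add distrib_left distrib_right sum.distrib del: Re_sum)

lemma Lh_scale: "Lh \<rho> \<delta> N p (\<lambda>j. a * f j) i = a * Lh \<rho> \<delta> N p f i"
proof -
  have "Lh_sum \<rho> \<delta> N p (\<lambda>j. a * f j) i = of_real a * Lh_sum \<rho> \<delta> N p f i"
    by (simp add: Lh_sum_def dft_scale sum_distrib_left mult_ac)
  then show ?thesis by (simp add: Lh_def)
qed

lemma Re_of_real_mult: "Re (of_real a * z) = a * Re z"
  by simp

text \<open>
  The diagonal form of the operator. As \<open>g\<close> is real, summing the characters against \<open>g\<close> gives
  the conjugate of its Fourier coefficient directly, without Parseval's identity. Symmetry and
  positivity of all powers of the operator can be read off the right-hand side, because \<open>powr\<close>
  never takes negative values.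
\<close>
lemma inner_Lh:
  fixes f g :: "'d::finite gridfun"
  assumes N: "N > 0"
  shows "inner_h N (Lh \<rho> \<delta> N p f) g =
    (2 * pi) ^ CARD('d) * (\<Sum>k\<in>Shat N - {0}. symb \<rho> \<delta> k powr p * Re (dft N f k * cnj (dft N g k)))"
proof -
  have dftg: "(\<Sum>j\<in>Sh N. cis (real_vec k \<bullet> gridpt N j) * of_real (g j))
      = of_nat N ^ CARD('d) * cnj (dft N g k)" for k
    using N by (simp add: dft_def cis_cnj mult.commute)
  have "(\<Sum>j\<in>Sh N. Lh_sum \<rho> \<delta> N p f j * of_real (g j))
      = (\<Sum>j\<in>Sh N. \<Sum>k\<in>Shat N - {0}. of_real (symb \<rho> \<delta> k powr p) * dft N f k
           * (cis (real_vec k \<bullet> gridpt N j) * of_real (g j)))"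
    unfolding Lh_sum_def sum_distrib_right mult.assoc ..
  also have "\<dots> = (\<Sum>k\<in>Shat N - {0}. of_real (symb \<rho> \<delta> k powr p) * dft N f k
           * (of_nat N ^ CARD('d) * cnj (dft N g k)))"
    by (subst sum.swap) (simp add: dftg flip: sum_distrib_left)
  also have "\<dots> = of_real (real N ^ CARD('d)) * (\<Sum>k\<in>Shat N - {0}. of_real (symb \<rho> \<delta> k powr p) *
           (dft N f k * cnj (dft N g k)))"
    by (simp add: sum_distrib_left mult_ac)
  finally have "Re (\<Sum>j\<in>Sh N. Lh_sum \<rho> \<delta> N p f j * of_real (g j)) =
      real N ^ CARD('d) * (\<Sum>k\<in>Shat N - {0}. symb \<rho> \<delta> k powr p * Re (dft N f k * cnj (dft N g k)))"
    by (simp only: Re_of_real_mult Re_sum mult.assoc)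
  then show ?thesis
    unfolding inner_h_def Lh_def mesh_power[OF N, symmetric] by simp
qed

lemma dft_Lh:
  fixes f :: "'d::finite gridfun"
  assumes N: "N > 0" "even N" and l: "l \<in> Shat N - {0}"
  shows "dft N (Lh \<rho> \<delta> N p f) l = of_real (symb \<rho> \<delta> l powr p) * dft N f l"
proof -
  have real: "of_real (Lh \<rho> \<delta> N p f j) = Lh_sum \<rho> \<delta> N p f j" for j
    using Lh_sum_real[OF N(2,1), of \<rho> \<delta> p f j] by (simp add: Lh_def complex_eq_iff)
  have "(\<Sum>j\<in>Sh N. Lh_sum \<rho> \<delta> N p f j * cis (- (real_vec l \<bullet> gridpt N j)))
      = (\<Sum>k\<in>Shat N - {0}. of_real (symb \<rho> \<delta> k powr p) * dft N f k *
           (\<Sum>j\<in>Sh N. cis (real_vec k \<bullet> gridpt N j) * cis (- (real_vec l \<bullet> gridpt N j))))"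
    by (simp add: Lh_sum_def sum_distrib_left sum_distrib_right mult.assoc) (rule sum.swap)
  also have "\<dots> = (\<Sum>k\<in>Shat N - {0}. if k = l then
           of_real (symb \<rho> \<delta> k powr p) * dft N f k * of_nat N ^ CARD('d) else 0)"
    by (rule sum.cong) (use l N in \<open>auto simp: cis_orthogonal\<close>)
  also have "\<dots> = of_real (symb \<rho> \<delta> l powr p) * dft N f l * of_nat N ^ CARD('d)"
    using l by simp
  finally show ?thesis
    unfolding dft_def[of N "Lh \<rho> \<delta> N p f"] real using N by simp
qed

text \<open>
  Both sides equal the same spectral sum: the multiplier \<open>\<lambda>\<^bsup>p/2\<^esup>\<close> occurs once from each
  factor on the left, and the two combine to \<open>\<lambda>\<^bsup>p\<^esup>\<close>.
\<close>
lemma norm_Lh_half: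
  fixes f :: "'d::finite gridfun"
  assumes N: "N > 0" "even N"
  shows "inner_h N (Lh \<rho> \<delta> N (p / 2) f) (Lh \<rho> \<delta> N (p / 2) f) = inner_h N (Lh \<rho> \<delta> N p f) f"
proof -
  have half: "symb \<rho> \<delta> k powr (p / 2) * (symb \<rho> \<delta> k powr (p / 2) * x) = symb \<rho> \<delta> k powr p * x"
    for k :: "int ^ 'd" and x
    by (simp flip: mult.assoc powr_add)
  have "symb \<rho> \<delta> k powr (p / 2) * Re (dft N f k * cnj (dft N (Lh \<rho> \<delta> N (p / 2) f) k))
      = symb \<rho> \<delta> k powr p * Re (dft N f k * cnj (dft N f k))" if "k \<in> Shat N - {0}" for k
  proof -
    have "Re (dft N f k * cnj (dft N (Lh \<rho> \<delta> N (p / 2) f) k))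
        = symb \<rho> \<delta> k powr (p / 2) * Re (dft N f k * cnj (dft N f k))"
      unfolding dft_Lh[OF N that] by (simp add: algebra_simps)
    then show ?thesis by (simp only: half)
  qed
  then show ?thesis
    unfolding inner_Lh[OF N(1)] by simp
qed

section \<open>The grid inner product\<close>

lemma inner_h_commute: "inner_h N f g = inner_h N g f"
  by (simp add: inner_h_def mult.commute)

lemma inner_h_add: "inner_h N (\<lambda>j. f j + g j) h = inner_h N f h + inner_h N g h"
  by (simp add: inner_h_def algebra_simps sum.distrib)

lemma inner_h_scale: "inner_h N (\<lambda>j. a * f j) h = a * inner_h N f h"
  by (simp add: inner_h_def sum_distrib_left mult_ac)

lemma inner_h_mono:
  fixes f g f' g' :: "'d::finite gridfun"
  assumes "N > 0" "\<And>j. f j * g j \<le> f' j * g' j"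
  shows "inner_h N f g \<le> inner_h N f' g'"
  unfolding inner_h_def
  by (intro mult_left_mono sum_mono assms) (use mesh_pos[OF assms(1)] in simp)


lemma inner_h_nonneg: "N > 0 \<Longrightarrow> inner_h N f f \<ge> 0"
  unfolding inner_h_def using mesh_pos[of N]
  by (intro mult_nonneg_nonneg sum_nonneg zero_le_power zero_le_square) simp

lemma norm_h_sq: "N > 0 \<Longrightarrow> (norm_h N f)\<^sup>2 = inner_h N f f"
  by (simp add: norm_h_def inner_h_nonneg)

lemma inner_h_cauchy_schwarz:
  fixes f g :: "'d::finite gridfun"
  assumes N: "N > 0"
  shows "\<bar>inner_h N f g\<bar> \<le> norm_h N f * norm_h N g"
proof -
  have "(\<Sum>j\<in>Sh N. f j * g j)\<^sup>2 \<le> (\<Sum>j\<in>Sh N. (f j)\<^sup>2) * (\<Sum>j\<in>Sh N. (g j)\<^sup>2)"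
    by (rule Cauchy_Schwarz_ineq_sum)
  then have "(mesh N ^ CARD('d))\<^sup>2 * (\<Sum>j\<in>Sh N. f j * g j)\<^sup>2 \<le>
      (mesh N ^ CARD('d))\<^sup>2 * ((\<Sum>j\<in>Sh N. (f j)\<^sup>2) * (\<Sum>j\<in>Sh N. (g j)\<^sup>2))"
    by (rule mult_left_mono) simp
  then have "(inner_h N f g)\<^sup>2 \<le> inner_h N f f * inner_h N g g"
    unfolding inner_h_def power_mult_distrib by (simp only: power2_eq_square mult_ac)
  then have "sqrt ((inner_h N f g)\<^sup>2) \<le> sqrt (inner_h N f f * inner_h N g g)"
    by (rule real_sqrt_le_mono)
  then show ?thesis
    by (simp add: norm_h_def real_sqrt_mult)
qed

lemma norm_h_scale: "norm_h N (\<lambda>j. a * f j) = \<bar>a\<bar> * norm_h N f"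
proof -
  have "inner_h N (\<lambda>j. a * f j) (\<lambda>j. a * f j) = a\<^sup>2 * inner_h N f f"
    by (simp add: inner_h_scale inner_h_commute[of N f "\<lambda>j. a * f j"] power2_eq_square)
  then show ?thesis by (simp add: norm_h_def real_sqrt_mult)
qed

lemma abs_le_norm_h:
  fixes f :: "'d::finite gridfun"
  assumes N: "N > 0" and j: "j \<in> Sh N"
  shows "\<bar>f j\<bar> \<le> norm_h N f / sqrt (mesh N ^ CARD('d))"
proof -
  have "(f j)\<^sup>2 \<le> (\<Sum>j\<in>Sh N. (f j)\<^sup>2)" by (rule member_le_sum) (use j in auto)
  also have "\<dots> = inner_h N f f / mesh N ^ CARD('d)"
    using mesh_pos[OF N] by (simp add: inner_h_def power2_eq_square)
  finally have "sqrt ((f j)\<^sup>2) \<le> sqrt (inner_h N f f / mesh N ^ CARD('d))"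
    by (rule real_sqrt_le_mono)
  then show ?thesis by (simp add: norm_h_def real_sqrt_divide)
qed

section \<open>The operator norm\<close>

text \<open>
  Some finite bound is needed in order that the supremum in \<open>opnorm_h\<close> is meaningful. A crude one
  suffices: on a finite grid the norm controls every value of \<open>f\<close>, hence every Fourier
  coefficient, hence every value of the operator.
\<close>
lemma Lh_bounded:
  assumes N: "N > 0"
  obtains C where "\<And>f :: 'd::finite gridfun. norm_h N (Lh \<rho> \<delta> N p f) \<le> C * norm_h N f"
proof -
  define K where "K = (\<Sum>k\<in>Shat N - {0 :: int ^ 'd}. symb \<rho> \<delta> k powr p) / sqrt (mesh N ^ CARD('d))"
  define C where "C = sqrt (mesh N ^ CARD('d) * (real N ^ CARD('d) * K\<^sup>2))"
  have "norm_h N (Lh \<rho> \<delta> N p f) \<le> C * norm_h N f" for f :: "'d gridfun"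
  proof -
    let ?b = "norm_h N f / sqrt (mesh N ^ CARD('d))"
    have dft: "norm (dft N f k) \<le> ?b" for k
    proof -
      have "norm (\<Sum>j\<in>Sh N. of_real (f j) * cis (- (real_vec k \<bullet> gridpt N j))) \<le> (\<Sum>j\<in>(Sh N :: (int ^ 'd) set). ?b)"
        by (rule sum_norm_le) (simp add: norm_mult abs_le_norm_h[OF N])
      also have "\<dots> = real N ^ CARD('d) * ?b" by (simp add: card_Sh)
      finally show ?thesis
        using N by (simp add: dft_def norm_divide norm_power field_simps)
    qed
    have "\<bar>Lh \<rho> \<delta> N p f j\<bar> \<le> K * norm_h N f" for j
    proof -
      have "\<bar>Lh \<rho> \<delta> N p f j\<bar> \<le> norm (Lh_sum \<rho> \<delta> N p f j)"
        unfolding Lh_def by (rule abs_Re_le_cmod)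
      also have "\<dots> \<le> (\<Sum>k\<in>Shat N - {0 :: int ^ 'd}. symb \<rho> \<delta> k powr p * ?b)"
        unfolding Lh_sum_def by (rule sum_norm_le) (simp only: norm_mult norm_cis norm_of_real mult_1_right, use dft in \<open>auto intro!: mult_left_mono simp del: times_divide_eq_right\<close>)
      also have "\<dots> = K * norm_h N f"
        unfolding K_def sum_distrib_right[symmetric] by simp
      finally show ?thesis .
    qed
    then have "(Lh \<rho> \<delta> N p f j)\<^sup>2 \<le> (K * norm_h N f)\<^sup>2" for j
      by (metis abs_ge_zero power2_abs power_mono)
    then have "(\<Sum>j\<in>Sh N. (Lh \<rho> \<delta> N p f j)\<^sup>2) \<le> (\<Sum>j\<in>(Sh N :: (int ^ 'd) set). (K * norm_h N f)\<^sup>2)"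
      by (intro sum_mono)
    then have "inner_h N (Lh \<rho> \<delta> N p f) (Lh \<rho> \<delta> N p f) \<le>
        mesh N ^ CARD('d) * (real N ^ CARD('d) * (K * norm_h N f)\<^sup>2)"
      using mesh_pos[OF N] by (simp add: inner_h_def card_Sh power2_eq_square)
    then have "norm_h N (Lh \<rho> \<delta> N p f) \<le> sqrt (mesh N ^ CARD('d) * (real N ^ CARD('d) * K\<^sup>2) * (norm_h N f)\<^sup>2)"
      unfolding norm_h_def[of N "Lh \<rho> \<delta> N p f"]
      by (intro real_sqrt_le_mono) (simp add: power_mult_distrib mult_ac)
    also have "\<dots> = C * norm_h N f"
      unfolding C_def real_sqrt_mult[of _ "(norm_h N f)\<^sup>2"]
      by (simp add: norm_h_def inner_h_nonneg[OF N])
    finally show ?thesis .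
  qed
  then show ?thesis by (rule that)
qed

text \<open>
  Scaling to the unit ball, where the supremum applies. A grid function of norm 0 cannot be scaled;
  for it the crude bound gives the claim.
\<close>
lemma norm_Lh_le_opnorm:
  fixes f :: "'d::finite gridfun"
  assumes N: "N > 0" and f: "f \<in> Mh N"
  shows "norm_h N (Lh \<rho> \<delta> N p f) \<le> opnorm_h N (Lh \<rho> \<delta> N p :: 'd gridfun \<Rightarrow> 'd gridfun) * norm_h N f"
proof -
  let ?T = "Lh \<rho> \<delta> N p :: 'd gridfun \<Rightarrow> 'd gridfun"
  obtain C where C: "\<And>f :: 'd gridfun. norm_h N (?T f) \<le> C * norm_h N f"
    using Lh_bounded[OF N] by blast
  have nn: "0 \<le> norm_h N g" for g :: "'d gridfun"
    by (simp add: norm_h_def inner_h_nonneg[OF N])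
  have bdd: "bdd_above ((\<lambda>f. norm_h N (?T f)) ` {f \<in> Mh N. norm_h N f \<le> 1})"
  proof (rule bdd_aboveI2)
    fix g :: "'d gridfun" assume "g \<in> {f \<in> Mh N. norm_h N f \<le> 1}"
    then have "\<bar>C\<bar> * norm_h N g \<le> \<bar>C\<bar> * 1" by (intro mult_left_mono) auto
    moreover have "C * norm_h N g \<le> \<bar>C\<bar> * norm_h N g" by (intro mult_right_mono nn) auto
    ultimately show "norm_h N (?T g) \<le> \<bar>C\<bar>" using C[of g] by linarith
  qed
  show ?thesis
  proof (cases "norm_h N f = 0")
    case True
    then show ?thesis using C[of f] by simp
  next
    case False
    then have pos: "norm_h N f > 0" using nn[of f] by linarith
    define g where "g = (\<lambda>j. inverse (norm_h N f) * f j)"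
    have "g \<in> {f \<in> Mh N. norm_h N f \<le> 1}"
      using f pos by (auto simp: g_def Mh_def norm_h_scale)
    then have "norm_h N (?T g) \<le> opnorm_h N ?T"
      unfolding opnorm_h_def by (rule cSUP_upper[OF _ bdd])
    moreover have "norm_h N (?T g) = inverse (norm_h N f) * norm_h N (?T f)"
    proof -
      have "?T g = (\<lambda>i. inverse (norm_h N f) * ?T f i)"
        unfolding g_def by (rule ext) (rule Lh_scale)
      then show ?thesis using pos by (simp add: norm_h_scale)
    qed
    ultimately show ?thesis using pos by (simp add: field_simps)
  qed
qed

section \<open>Positive semidefinite forms in a two-step scheme\<close>

text \<open>
  In the lemmas below, \<open>p\<close>, \<open>u\<close>, \<open>v\<close> are consecutive iterates, the newest first.
\<close>
locale nonneg_symmetric_form =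
  fixes b :: "'d::finite gridfun \<Rightarrow> 'd gridfun \<Rightarrow> real"
  assumes commute: "b f g = b g f"
    and add: "b (\<lambda>j. f j + g j) h = b f h + b g h"
    and scale: "b (\<lambda>j. x * f j) h = x * b f h"
    and nonneg: "0 \<le> b f f"
begin

lemma diff: "b (\<lambda>j. f j - g j) h = b f h - b g h"
  using add[of f "\<lambda>j. (-1) * g j" h] scale[of "-1" g h] by simp

lemma linear_right:
  "b h (\<lambda>j. f j + g j) = b h f + b h g"
  "b h (\<lambda>j. f j - g j) = b h f - b h g"
  "b h (\<lambda>j. x * f j) = x * b h f"
  by (simp_all only: commute[of h] add diff scale)

lemmas expand = add diff scale linear_right

text \<open>
  The identity \<open>b p (p - u) = (b p p - b u u + b (p - u) (p - u)) / 2\<close> without its last,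
  nonnegative term.
\<close>
lemma implicit_term:
  "(b p p - b u u) / 2 \<le> b p (\<lambda>j. p j - u j)"
  using nonneg[of "\<lambda>j. p j - u j"] by (simp add: expand commute[of u p])

text \<open>
  With \<open>a = p - u\<close> and \<open>c = u - v\<close> the extrapolation is \<open>2 u - v = u + c\<close>. Polarisation gives
  \<open>b u a = (b p p - b u u - b a a) / 2\<close>, and \<open>b (a + c) (a + c) \<ge> 0\<close> gives
  \<open>b c a \<ge> - (b a a + b c c) / 2\<close>. The explicit treatment thus loses the two quadratic terms,
  for which bounds \<open>x\<close> and \<open>y\<close> are supplied.
\<close>
lemma extrapolated_term:
  assumes bound: "b (\<lambda>j. p j - u j) (\<lambda>j. p j - u j) \<le> x" "b (\<lambda>j. u j - v j) (\<lambda>j. u j - v j) \<le> y"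
  shows "(b p p - b u u) / 2 - x / 2 - (x + y) / 2
    \<le> b (\<lambda>j. 2 * u j - v j) (\<lambda>j. p j - u j)"
  using nonneg[of "\<lambda>j. (p j - u j) + (u j - v j)"]
 bound
  by (simp only: expand commute[of u p] commute[of v p] commute[of v u]) (simp add: field_simps)

text \<open>
  The second difference is \<open>a - c\<close> with \<open>a = p - u\<close> and \<open>c = u - v\<close>, so this is the inequality of
  \<open>implicit_term\<close> for \<open>a\<close> and \<open>c\<close>.
\<close>
lemma stabilising_term:
  "(b (\<lambda>j. p j - u j) (\<lambda>j. p j - u j) - b (\<lambda>j. u j - v j) (\<lambda>j. u j - v j)) / 2
    \<le> b (\<lambda>j. p j - 2 * u j + v j) (\<lambda>j. p j - u j)"
  using nonneg[of "\<lambda>j. (p j - u j) - (u j - v j)"]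
  by (simp only: expand commute[of u p] commute[of v p] commute[of v u])
     (simp add: field_simps)

text \<open>
  Here \<open>3 p - 4 u + v = 3 a - c\<close> with \<open>a = p - u\<close> and \<open>c = u - v\<close>, and
  \<open>b c a \<le> (b a a + b c c) / 2\<close>.
\<close>
lemma backward_difference_term:
  "2 * b (\<lambda>j. p j - u j) (\<lambda>j. p j - u j)
     + (b (\<lambda>j. p j - u j) (\<lambda>j. p j - u j) - b (\<lambda>j. u j - v j) (\<lambda>j. u j - v j)) / 2
    \<le> b (\<lambda>j. 3 * p j - 4 * u j + v j) (\<lambda>j. p j - u j)"
  using nonneg[of "\<lambda>j. (p j - u j) - (u j - v j)"]
  by (simp only: expand commute[of u p] commute[of v p] commute[of v u])
     (simp add: field_simps)

end

lemma nonneg_symmetric_form_inner_h: "N > 0 \<Longrightarrow> nonneg_symmetric_form (inner_h N)"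
  by unfold_locales (rule inner_h_commute inner_h_add inner_h_scale inner_h_nonneg; assumption?)+

lemma nonneg_symmetric_form_Lh:
  assumes N: "N > 0"
  shows "nonneg_symmetric_form (\<lambda>f g. inner_h N (Lh \<rho> \<delta> N p f) g)"
proof
  fix f g h :: "'a gridfun" and x :: real
  show "inner_h N (Lh \<rho> \<delta> N p f) g = inner_h N (Lh \<rho> \<delta> N p g) f"
    unfolding inner_Lh[OF N] by (simp add: mult.commute)
  show "inner_h N (Lh \<rho> \<delta> N p (\<lambda>j. f j + g j)) h = inner_h N (Lh \<rho> \<delta> N p f) h + inner_h N (Lh \<rho> \<delta> N p g) h"
    unfolding Lh_add [abs_def] by (rule inner_h_add)
  show "inner_h N (Lh \<rho> \<delta> N p (\<lambda>j. x * f j)) h = x * inner_h N (Lh \<rho> \<delta> N p f) h"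
    unfolding Lh_scale [abs_def] by (rule inner_h_scale)
  show "0 \<le> inner_h N (Lh \<rho> \<delta> N p f) f"
    unfolding inner_Lh[OF N]
    by (intro mult_nonneg_nonneg sum_nonneg) (simp_all add: complex_mult_cnj)
qed

lemma nonneg_symmetric_form_mass: "nonneg_symmetric_form (\<lambda>f g :: 'd::finite gridfun. inner_h N f (\<lambda>_. 1) * inner_h N g (\<lambda>_. 1))"
  by unfold_locales (simp_all add: inner_h_add inner_h_scale algebra_simps)

section \<open>Quadratic bounds\<close>

lemma inner_h_one:
  assumes "N > 0"
  shows "inner_h N (\<lambda>_. 1) (\<lambda>_ :: int ^ 'd::finite. 1) = vol_dom TYPE('d)"
  using mesh_power[OF assms, of "CARD('d)"] by (simp add: inner_h_def vol_dom_def card_Sh)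

text \<open>
  Cauchy--Schwarz against the constant 1; this is where the volume of the domain enters the
  constant of the theorem.
\<close>
lemma mass_le:
  fixes f :: "'d::finite gridfun"
  assumes N: "N > 0"
  shows "inner_h N f (\<lambda>_. 1) * inner_h N f (\<lambda>_. 1) \<le> vol_dom TYPE('d) * inner_h N f f"
proof -
  have "\<bar>inner_h N f (\<lambda>_. 1)\<bar>\<^sup>2 \<le> (norm_h N f * norm_h N (\<lambda>_ :: int ^ 'd. 1))\<^sup>2"
    by (intro power_mono inner_h_cauchy_schwarz N) simp
  then show ?thesis
    unfolding power2_abs power_mult_distrib norm_h_sq[OF N] inner_h_one[OF N]
    by (simp only: power2_eq_square mult.commute)
qed

lemma inner_Lh_le_opnorm:
  fixes f :: "'d::finite gridfun"
  assumes N: "N > 0" and f: "f \<in> Mh N"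
  shows "inner_h N (Lh \<rho> \<delta> N p f) f
    \<le> opnorm_h N (Lh \<rho> \<delta> N p :: 'd gridfun \<Rightarrow> 'd gridfun) * inner_h N f f"
proof -
  have "inner_h N (Lh \<rho> \<delta> N p f) f \<le> norm_h N (Lh \<rho> \<delta> N p f) * norm_h N f"
    using inner_h_cauchy_schwarz[OF N, of "Lh \<rho> \<delta> N p f" f] by linarith
  also have "\<dots> \<le> (opnorm_h N (Lh \<rho> \<delta> N p :: 'd gridfun \<Rightarrow> 'd gridfun) * norm_h N f) * norm_h N f"
    by (intro mult_right_mono norm_Lh_le_opnorm N f) (simp add: norm_h_def inner_h_nonneg[OF N])
  finally show ?thesis
    by (simp add: norm_h_sq[OF N, symmetric] power2_eq_square mult.assoc)
qed

section \<open>Energy decay\<close>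

lemma inner_h_W_extrapolated_le:
  fixes p u v :: "'d::finite gridfun"
  assumes N: "N > 0" and c: "c > 0"
  shows "inner_h N (\<lambda>j. - (2 * deriv (W c) (u j) - deriv (W c) (v j))) (\<lambda>j. p j - u j)
    \<le> inner_h N (\<lambda>j. W c (u j)) (\<lambda>_. 1) - inner_h N (\<lambda>j. W c (p j)) (\<lambda>_. 1)
      + LW2 c / 2 * (2 * inner_h N (\<lambda>j. p j - u j) (\<lambda>j. p j - u j)
                      + inner_h N (\<lambda>j. u j - v j) (\<lambda>j. u j - v j))"
proof -
  have sq: "inner_h N f f = inner_h N (\<lambda>j. f j * f j) (\<lambda>_. 1)" for f :: "'d gridfun"
    by (simp add: inner_h_def)
  have "inner_h N (\<lambda>j. - (2 * deriv (W c) (u j) - deriv (W c) (v j))) (\<lambda>j. p j - u j)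
    \<le> inner_h N (\<lambda>j. W c (u j) + ((-1) * W c (p j) + LW2 c / 2 *
         (2 * ((p j - u j) * (p j - u j)) + (u j - v j) * (u j - v j)))) (\<lambda>_. 1)"
  proof (rule inner_h_mono[OF N])
    fix j
    show "- (2 * deriv (W c) (u j) - deriv (W c) (v j)) * (p j - u j)
      \<le> (W c (u j) + ((-1) * W c (p j) + LW2 c / 2 *
         (2 * ((p j - u j) * (p j - u j)) + (u j - v j) * (u j - v j)))) * 1"
      using W_extrapolated_le[OF c, of "u j" "v j" "p j"]
      by (simp add: power2_eq_square algebra_simps)
  qed
  then show ?thesis
    unfolding sq inner_h_add inner_h_scale by simp
qed

text \<open>
  One step of the scheme, tested with \<open>a = p - u\<close>. The facts \<open>t1\<close> to \<open>t7\<close> estimate the terms of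
  the tested equation \<open>tested\<close> one by one, and \<open>t0\<close> is the step size restriction.
\<close>
lemma bdf2_step_energy_le:
  fixes p u v :: "'d::finite gridfun"
  assumes pos: "\<epsilon> > 0" "\<gamma> > 0" "M > 0" "Mcut > 0" "\<tau> > 0" "A \<ge> 0" "B \<ge> 0"
    and N: "N > 0" "even N"
    and grid: "p \<in> Mh N" "u \<in> Mh N" "v \<in> Mh N"
    and step: "bdf2_step \<epsilon> \<gamma> M \<omega> Mcut \<rho> \<delta> N A B \<tau> v u p"
    and \<tau>: "\<tau> \<le> 1 / (3 * Ch TYPE('d) \<epsilon> \<gamma> M Mcut \<rho> \<delta> N)"
  shows "Eh_mod \<epsilon> \<gamma> M \<omega> Mcut \<rho> \<delta> N A B \<tau> p u \<le> Eh_mod \<epsilon> \<gamma> M \<omega> Mcut \<rho> \<delta> N A B \<tau> u v"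
proof -
  define a where "a = (\<lambda>j. p j - u j)"
  define c where "c = (\<lambda>j. u j - v j)"
  define K where "K = opnorm_h N (Lh \<rho> \<delta> N (-1) :: 'd gridfun \<Rightarrow> 'd gridfun)"
  define V where "V = vol_dom TYPE('d)"
  define C where "C = Ch TYPE('d) \<epsilon> \<gamma> M Mcut \<rho> \<delta> N"
  define w where "w = (\<lambda>j. - (2 * deriv (W Mcut) (u j) - deriv (W Mcut) (v j)))"
  define m where "m = inner_h N (\<lambda>i. 2 * u i - v i) (\<lambda>_. 1) - \<omega> * V"
  define G where "G = (\<lambda>f g :: 'd gridfun. inner_h N (Lh \<rho> \<delta> N (-1) f) g)"
  interpret I: nonneg_symmetric_form "inner_h N :: 'd gridfun \<Rightarrow> _"
    by (rule nonneg_symmetric_form_inner_h[OF N(1)])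
  interpret L: nonneg_symmetric_form "\<lambda>f g :: 'd gridfun. inner_h N (Lh \<rho> \<delta> N 1 f) g"
    by (rule nonneg_symmetric_form_Lh[OF N(1)])
  interpret G: nonneg_symmetric_form G
    unfolding G_def by (rule nonneg_symmetric_form_Lh[OF N(1)])
  interpret Ma: nonneg_symmetric_form "\<lambda>f g :: 'd gridfun. inner_h N f (\<lambda>_. 1) * inner_h N g (\<lambda>_. 1)"
    by (rule nonneg_symmetric_form_mass)
  \<comment> \<open>Energies are centred at \<open>\<omega>\<close>; differences of iterates and the extrapolation \<open>2 u - v\<close> are
    compatible with this shift.\<close>
  have shift: "(\<lambda>j. (p j - \<omega>) - (u j - \<omega>)) = a" "(\<lambda>j. (u j - \<omega>) - (v j - \<omega>)) = c"
    "(\<lambda>j. 2 * (u j - \<omega>) - (v j - \<omega>)) = (\<lambda>j. 2 * u j - v j - \<omega>)"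
    by (simp_all add: a_def c_def algebra_simps)
  have aM: "a \<in> Mh N" "c \<in> Mh N"
    using grid by (simp_all add: a_def c_def Mh_def)
  have m: "m = inner_h N (\<lambda>j. 2 * u j - v j - \<omega>) (\<lambda>_. 1)"
    using I.scale[of \<omega> "\<lambda>_. 1" "\<lambda>_. 1"] by (simp add: m_def V_def I.diff inner_h_one[OF N(1)])
  have "(\<lambda>j. 1 / (2 * \<tau>) * (3 * p j - 4 * u j + v j)) = (\<lambda>j. (- \<epsilon>) * Lh \<rho> \<delta> N 1 p j + (1 / \<epsilon> * w j +
      ((- \<gamma> * B) * Lh \<rho> \<delta> N (-1) (\<lambda>i. p i - 2 * u i + v i) j + ((- A) * (p j - 2 * u j + v j) +
      ((- \<gamma>) * Lh \<rho> \<delta> N (-1) (\<lambda>i. 2 * u i - v i - \<omega>) j + (- M * m) * 1)))))"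
  proof
    fix j
    show "1 / (2 * \<tau>) * (3 * p j - 4 * u j + v j) = (- \<epsilon>) * Lh \<rho> \<delta> N 1 p j + (1 / \<epsilon> * w j +
      ((- \<gamma> * B) * Lh \<rho> \<delta> N (-1) (\<lambda>i. p i - 2 * u i + v i) j + ((- A) * (p j - 2 * u j + v j) +
      ((- \<gamma>) * Lh \<rho> \<delta> N (-1) (\<lambda>i. 2 * u i - v i - \<omega>) j + (- M * m) * 1))))"
      using step[unfolded bdf2_step_def, rule_format, of j] unfolding w_def m_def V_def
      by (simp add: algebra_simps diff_divide_distrib add_divide_distrib)
  qed
  then have "inner_h N (\<lambda>j. 1 / (2 * \<tau>) * (3 * p j - 4 * u j + v j)) a = inner_h N \<dots> a"
    by (rule arg_cong)
  then have tested: "1 / (2 * \<tau>) * inner_h N (\<lambda>j. 3 * p j - 4 * u j + v j) a =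
      - \<epsilon> * inner_h N (Lh \<rho> \<delta> N 1 p) a + (1 / \<epsilon> * inner_h N w a
      + ((- \<gamma> * B) * G (\<lambda>i. p i - 2 * u i + v i) a + ((- A) * inner_h N (\<lambda>i. p i - 2 * u i + v i) a
      + ((- \<gamma>) * G (\<lambda>i. 2 * u i - v i - \<omega>) a + (- M * m) * inner_h N (\<lambda>_. 1) a))))"
    \<comment> \<open>Additivity is restricted to sums of products, so that the iterates inside the arguments stay together.\<close>
    unfolding G_def I.scale I.add[of "\<lambda>j. x j * y j" for x y] I.add[of "\<lambda>j. x * y j" for x y] .
  define X where "X = inner_h N a a"
  define Y where "Y = inner_h N c c"
  define T where "T = 1 / \<tau>"
  define e where "e = 1 / \<epsilon>"
  have C: "C = e * LW2 Mcut / 2 + \<gamma> / 2 * K + M / 2 * V"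
    by (simp add: C_def Ch_def K_def V_def e_def)
  \<comment> \<open>Positivity of \<open>C\<close> is forced by the step size restriction, since \<open>\<tau>\<close> is positive and \<open>1 / 0 = 0\<close>.\<close>
  have "0 < 1 / (3 * C)"
    using \<tau> pos(5) unfolding C_def by linarith
  then have "0 < C" by simp
  then have "3 * C \<le> T"
    using \<tau> pos(5) by (simp add: T_def C_def[symmetric] field_simps)
  moreover have "0 \<le> X"
    unfolding X_def by (rule I.nonneg)
  ultimately have t0: "3 * C * X \<le> T * X"
    by (rule mult_right_mono)
  have "2 * X + (X - Y) / 2 \<le> inner_h N (\<lambda>j. 3 * p j - 4 * u j + v j) a"
    unfolding X_def Y_def a_def c_def by (rule I.backward_difference_term)
  from mult_left_mono[OF this, of "T / 2"]
  have t1: "T / 2 * (2 * X + (X - Y) / 2) \<le> T / 2 * inner_h N (\<lambda>j. 3 * p j - 4 * u j + v j) a"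
    using pos by (simp add: T_def)
  have t2: "\<epsilon> * ((inner_h N (Lh \<rho> \<delta> N 1 p) p - inner_h N (Lh \<rho> \<delta> N 1 u) u) / 2)
      \<le> \<epsilon> * inner_h N (Lh \<rho> \<delta> N 1 p) a"
    unfolding a_def by (intro mult_left_mono L.implicit_term) (use pos in simp)
  have t3: "e * inner_h N w a \<le> e * (inner_h N (\<lambda>j. W Mcut (u j)) (\<lambda>_. 1)
      - inner_h N (\<lambda>j. W Mcut (p j)) (\<lambda>_. 1) + LW2 Mcut / 2 * (2 * X + Y))"
    unfolding w_def a_def c_def X_def Y_def
    by (intro mult_left_mono inner_h_W_extrapolated_le N pos) (use pos in \<open>simp add: e_def\<close>)
  have t4: "\<gamma> * B * ((G a a - G c c) / 2) \<le> \<gamma> * B * G (\<lambda>i. p i - 2 * u i + v i) a"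
    unfolding a_def c_def by (intro mult_left_mono G.stabilising_term) (use pos in simp)
  have t5: "A * ((X - Y) / 2) \<le> A * inner_h N (\<lambda>i. p i - 2 * u i + v i) a"
    unfolding X_def Y_def a_def c_def by (intro mult_left_mono I.stabilising_term pos)
  have "(G (\<lambda>j. p j - \<omega>) (\<lambda>j. p j - \<omega>) - G (\<lambda>j. u j - \<omega>) (\<lambda>j. u j - \<omega>)) / 2
      - K * X / 2 - (K * X + K * Y) / 2 \<le> G (\<lambda>i. 2 * u i - v i - \<omega>) a"
    using G.extrapolated_term[of "\<lambda>j. p j - \<omega>" "\<lambda>j. u j - \<omega>" "K * X" "\<lambda>j. v j - \<omega>"
        "K * Y"] inner_Lh_le_opnorm[OF N(1) aM(1), of \<rho> \<delta> "-1"]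
      inner_Lh_le_opnorm[OF N(1) aM(2), of \<rho> \<delta> "-1"]
    unfolding shift X_def Y_def G_def K_def by auto
  from mult_left_mono[OF this, of \<gamma>]
  have t6: "\<gamma> * ((G (\<lambda>j. p j - \<omega>) (\<lambda>j. p j - \<omega>) - G (\<lambda>j. u j - \<omega>) (\<lambda>j. u j - \<omega>)) / 2
      - K * X / 2 - (K * X + K * Y) / 2) \<le> \<gamma> * G (\<lambda>i. 2 * u i - v i - \<omega>) a"
    using pos by simp
  have "((inner_h N (\<lambda>j. p j - \<omega>) (\<lambda>_. 1))\<^sup>2 - (inner_h N (\<lambda>j. u j - \<omega>) (\<lambda>_. 1))\<^sup>2) / 2
      - V * X / 2 - (V * X + V * Y) / 2 \<le> m * inner_h N (\<lambda>_. 1) a"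
    using Ma.extrapolated_term[of "\<lambda>j. p j - \<omega>" "\<lambda>j. u j - \<omega>" "V * X" "\<lambda>j. v j - \<omega>"
        "V * Y"] mass_le[OF N(1), of a] mass_le[OF N(1), of c]
    unfolding shift X_def Y_def V_def m power2_eq_square inner_h_commute[of N "\<lambda>_. 1" a] by auto
  from mult_left_mono[OF this, of M]
  have t7: "M * (((inner_h N (\<lambda>j. p j - \<omega>) (\<lambda>_. 1))\<^sup>2 - (inner_h N (\<lambda>j. u j - \<omega>) (\<lambda>_. 1))\<^sup>2) / 2
      - V * X / 2 - (V * X + V * Y) / 2) \<le> M * (m * inner_h N (\<lambda>_. 1) a)"
    using pos by simp
  have half: "(norm_h N (Lh \<rho> \<delta> N (-1/2) f))\<^sup>2 = G f f" for f :: "'d gridfun"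
    unfolding norm_h_sq[OF N(1)] G_def by (rule norm_Lh_half[OF N])
  have coeff: "1 / (4 * \<tau>) = T / 4" "1 / (2 * \<tau>) = T / 2"
    by (simp_all add: T_def)
  have mod: "Eh_mod \<epsilon> \<gamma> M \<omega> Mcut \<rho> \<delta> N A B \<tau> f g =
      \<epsilon> / 2 * inner_h N (Lh \<rho> \<delta> N 1 f) f + e * inner_h N (\<lambda>j. W Mcut (f j)) (\<lambda>_. 1)
      + \<gamma> / 2 * G (\<lambda>j. f j - \<omega>) (\<lambda>j. f j - \<omega>) + M / 2 * (inner_h N (\<lambda>j. f j - \<omega>) (\<lambda>_. 1))\<^sup>2
      + (A / 2 + T / 4 + C) * inner_h N (\<lambda>j. f j - g j) (\<lambda>j. f j - g j)
      + \<gamma> * B / 2 * G (\<lambda>j. f j - g j) (\<lambda>j. f j - g j)" for f g :: "'d gridfun"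
    unfolding Eh_mod_def Eh_def half
    unfolding norm_h_sq[OF N(1)] coeff C_def e_def G_def ..
  show ?thesis
    using tested t0 t1 t2 t3 t4 t5 t6 t7
    unfolding mod a_def[symmetric] c_def[symmetric] X_def[symmetric] Y_def[symmetric] coeff e_def[symmetric] C
    by (simp add: algebra_simps diff_divide_distrib add_divide_distrib)
qed

theorem theorem4p1:
  fixes \<epsilon> \<gamma> M \<omega> Mcut A B \<delta> \<tau> :: real
    and \<rho> :: "real \<Rightarrow> real"
    and N :: nat
    and U :: "int \<Rightarrow> 'd::finite gridfun"
  assumes "CARD('d) \<in> {1, 2, 3}"
    and "\<epsilon> > 0" and "\<gamma> > 0" and "M > 0" and "0 < \<omega>" and "\<omega> < 1/2"
    and "Mcut > 0" and "\<delta> > 0" and "\<tau> > 0"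
    and "admissible_kernel CARD('d) \<rho>"
    and "N > 0" and "even N"
    and "\<forall>n\<ge>-1. U n \<in> Mh N"
    and "\<forall>n\<ge>0. bdf2_step \<epsilon> \<gamma> M \<omega> Mcut \<rho> \<delta> N A B \<tau> (U (n - 1)) (U n) (U (n + 1))"
    and "A \<ge> 0" and "B \<ge> 0"
    and "\<tau> \<le> 1 / (3 * Ch TYPE('d) \<epsilon> \<gamma> M Mcut \<rho> \<delta> N)"
  shows "(\<forall>n\<ge>0. Eh_mod \<epsilon> \<gamma> M \<omega> Mcut \<rho> \<delta> N A B \<tau> (U (n + 1)) (U n)
               \<le> Eh_mod \<epsilon> \<gamma> M \<omega> Mcut \<rho> \<delta> N A B \<tau> (U n) (U (n - 1)))
       \<and> (A = 0 \<and> B = 0 \<longrightarrow>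
           (\<forall>n\<ge>0. Eh \<epsilon> \<gamma> M \<omega> Mcut \<rho> \<delta> N (U (n + 1))
                   + (1 / (4 * \<tau>) + Ch TYPE('d) \<epsilon> \<gamma> M Mcut \<rho> \<delta> N)
                     * (norm_h N (\<lambda>j. U (n + 1) j - U n j))\<^sup>2
                 \<le> Eh \<epsilon> \<gamma> M \<omega> Mcut \<rho> \<delta> N (U n)
                   + (1 / (4 * \<tau>) + Ch TYPE('d) \<epsilon> \<gamma> M Mcut \<rho> \<delta> N)
                     * (norm_h N (\<lambda>j. U n j - U (n - 1) j))\<^sup>2))"
proof -
  have decay: "Eh_mod \<epsilon> \<gamma> M \<omega> Mcut \<rho> \<delta> N A B \<tau> (U (n + 1)) (U n)
      \<le> Eh_mod \<epsilon> \<gamma> M \<omega> Mcut \<rho> \<delta> N A B \<tau> (U n) (U (n - 1))" if "n \<ge> 0" for n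
    using assms that by (intro bdf2_step_energy_le) auto
  then show ?thesis
    by (auto simp: Eh_mod_def)
qed

end
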